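(* Let $\lambda\in\mathbb{C}$ and let $K_V, K_G>0$. Then there exist constants $\gamma_0>0$ and $C>0$, depending only on $\lambda$, $K_V$, $K_G$, such that the following holds. Let $L\ge 1$, let $N\ge 1$ be an integer with $\Delta x = L/N\le 1$, and let $V:\mathcal{X}\to\mathbb{R}$ satisfy $\|V\|_{L^\infty(\mathcal{X})}\le K_V$. Assume that $\lambda-H$ is invertible with $\|(\lambda-H)^{-1}\|_{\mathcal{L}(L^2(\mathcal{X}))}\le K_G$, where $H=-\mathcal{D}^+\mathcal{D}^-+V$. Then for all $0\le\gamma\le\gamma_0$, $$\sup_{y\in\mathcal{X}}\ \bigl\|\exp(\gamma d_L(\cdot,y))\,(\lambda-H)^{-1}\,\exp(-\gamma d_L(\cdot,y))\bigr\|_{\mathcal{L}(L^2(\mathcal{X}))}\le C .$$ Here $\exp(\pm\gamma d_L(\cdot,y))$ denotes the multiplication operator $f(x)\mapsto \exp(\pm\gamma d_L(x,y))f(x)$, $x\in\mathcal{X}$.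
   Context: For $L>0$ and a positive integer $N$, put $\Delta x=L/N$ and $\mathcal{X}=\{x_i=i\Delta x: i=0,1,\dots,N-1\}$. Functions on $\mathcal{X}$ (complex-valued) are extended $L$-periodically to $\Delta x\,\mathbb{Z}$. Norms: $\|f\|_{L^2(\mathcal{X})}^2=\Delta x\sum_{x\in\mathcal{X}}|f(x)|^2$, $\|f\|_{L^\infty(\mathcal{X})}=\max_{x\in\mathcal{X}}|f(x)|$; $\|\cdot\|_{\mathcal{L}(L^2(\mathcal{X}))}$ is the induced operator norm (the matrix 2-norm). Difference operators (with periodic extension): $(\mathcal{D}^+f)(x)=\frac{1}{\Delta x}(f(x+\Delta x)-f(x))$, $(\mathcal{D}^-f)(x)=\frac{1}{\Delta x}(f(x)-f(x-\Delta x))$. The discretized Hamiltonian is $H=-\mathcal{D}^+\mathcal{D}^-+V$, with $V$ acting by multiplication; $\lambda$ also denotes $\lambda I$. Smoothed periodic distance: $\widetilde d_L(x,y)=\min\{|x-y-Lk|:k\in\mathbb{Z}\}$, $d_{\max}=(L^2/4+1)^{1/2}$, and $$d_L(x,y)=d_{\max}-\Bigl(\bigl[d_{\max}-(\widetilde d_L(x,y)^2+1)^{1/2}\bigr]^2+1\Bigr)^{1/2}.$$ *)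

theory Defs
  imports "HOL-Analysis.Analysis" "HOL-Library.Real_Mod"
begin

definition mesh :: "real \<Rightarrow> nat \<Rightarrow> real" where
  "mesh L N = L / real N"

definition grid :: "real \<Rightarrow> nat \<Rightarrow> real set" where
  "grid L N = (\<lambda>i. real i * mesh L N) ` {..<N}"

(* A complex function on the grid is an extensional function (value undefined
   off the grid), so that two grid functions are equal iff they agree on the grid. *)
definition grid_funs :: "real \<Rightarrow> nat \<Rightarrow> (real \<Rightarrow> complex) set" where
  "grid_funs L N = (grid L N \<rightarrow>\<^sub>E UNIV)"

(* x rmod L is the representative of x modulo L in [0, L); it maps
   the lattice (mesh L N) * Z onto the grid. Only values of f on [0, L) are used. *)
definition periodic_ext :: "real \<Rightarrow> (real \<Rightarrow> 'a) \<Rightarrow> real \<Rightarrow> 'a" where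
  "periodic_ext L f x = f (x rmod L)"

lemma periodic_ext_lattice:
  assumes "L > 0" "N > 0"
  shows "periodic_ext L f (real_of_int j * mesh L N) = f (real_of_int (j mod int N) * mesh L N)"
proof -
  have eq: "real_of_int j * mesh L N = real_of_int (j div int N) * L + real_of_int (j mod int N) * mesh L N"
  proof -
    have "real_of_int j = real_of_int (j div int N * int N + j mod int N)" by simp
    also have "\<dots> = real_of_int (j div int N) * real N + real_of_int (j mod int N)"
      by (simp only: of_int_add of_int_mult of_int_of_nat_eq)
    finally have "real_of_int j = real_of_int (j div int N) * real N + real_of_int (j mod int N)" .
    hence "real_of_int j * mesh L N = (real_of_int (j div int N) * real N + real_of_int (j mod int N)) * mesh L N"
      by (rule arg_cong)
    thus ?thesis using assms by (simp add: mesh_def field_simps)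
  qed
  have bnd: "0 \<le> real_of_int (j mod int N)" "real_of_int (j mod int N) < real N"
    using assms pos_mod_bound[of "int N" j] by (simp_all flip: of_int_less_iff[where 'a = real])
  have fl: "\<lfloor>real_of_int j * mesh L N / L\<rfloor> = j div int N"
    using assms bnd unfolding eq by (auto simp: floor_eq_iff mesh_def field_simps)
  show ?thesis unfolding periodic_ext_def rmod_def
    using assms fl eq by simp
qed

definition L2_norm :: "real \<Rightarrow> nat \<Rightarrow> (real \<Rightarrow> complex) \<Rightarrow> real" where
  "L2_norm L N f = sqrt (mesh L N * (\<Sum>x\<in>grid L N. (cmod (f x))\<^sup>2))"

definition Linf_norm :: "real \<Rightarrow> nat \<Rightarrow> (real \<Rightarrow> complex) \<Rightarrow> real" where
  "Linf_norm L N f = Max ((\<lambda>x. cmod (f x)) ` grid L N)"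

type_synonym grid_op = "(real \<Rightarrow> complex) \<Rightarrow> (real \<Rightarrow> complex)"

(* Carrier-relative analogue of onorm, for linear operators on grid_funs L N.
   The set of quotients is bounded, as grid_funs L N is finite-dimensional;
   f = 0 contributes 0 / 0 = 0. *)
definition op_norm :: "real \<Rightarrow> nat \<Rightarrow> grid_op \<Rightarrow> real" where
  "op_norm L N A = (SUP f\<in>grid_funs L N. L2_norm L N (A f) / L2_norm L N f)"

definition Dplus :: "real \<Rightarrow> nat \<Rightarrow> grid_op" where
  "Dplus L N f = (\<lambda>x\<in>grid L N.
     (periodic_ext L f (x + mesh L N) - f x) / of_real (mesh L N))"

definition Dminus :: "real \<Rightarrow> nat \<Rightarrow> grid_op" where
  "Dminus L N f = (\<lambda>x\<in>grid L N.
     (f x - periodic_ext L f (x - mesh L N)) / of_real (mesh L N))"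

definition mult_op :: "real \<Rightarrow> nat \<Rightarrow> (real \<Rightarrow> real) \<Rightarrow> grid_op" where
  "mult_op L N g f = (\<lambda>x\<in>grid L N. of_real (g x) * f x)"

definition hamiltonian :: "real \<Rightarrow> nat \<Rightarrow> (real \<Rightarrow> real) \<Rightarrow> grid_op" where
  "hamiltonian L N V f = (\<lambda>x\<in>grid L N.
     - Dplus L N (Dminus L N f) x + mult_op L N V f x)"

definition shifted :: "complex \<Rightarrow> real \<Rightarrow> nat \<Rightarrow> (real \<Rightarrow> real) \<Rightarrow> grid_op" where
  "shifted lam L N V f = (\<lambda>x\<in>grid L N. lam * f x - hamiltonian L N V f x)"

definition invertible_op :: "real \<Rightarrow> nat \<Rightarrow> grid_op \<Rightarrow> bool" where
  "invertible_op L N A \<longleftrightarrow> bij_betw A (grid_funs L N) (grid_funs L N)"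

definition inverse_op :: "real \<Rightarrow> nat \<Rightarrow> grid_op \<Rightarrow> grid_op" where
  "inverse_op L N A = inv_into (grid_funs L N) A"

(* For L > 0 the infimum over k is attained. *)
definition per_dist :: "real \<Rightarrow> real \<Rightarrow> real \<Rightarrow> real" where
  "per_dist L x y = (INF k::int. \<bar>x - y - L * of_int k\<bar>)"

definition d_max :: "real \<Rightarrow> real" where
  "d_max L = sqrt (L\<^sup>2 / 4 + 1)"

definition smooth_dist :: "real \<Rightarrow> real \<Rightarrow> real \<Rightarrow> real" where
  "smooth_dist L x y =
     d_max L - sqrt ((d_max L - sqrt ((per_dist L x y)\<^sup>2 + 1))\<^sup>2 + 1)"

end

(* Combes--Thomas argument in quadratic form. Write M = lambda - H. Conjugating M by exp(phi),
   phi = gamma d_L(.,y), perturbs the form <w, M u> by terms of size O(gamma) in the discrete H^1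
   norms of u and w, using only that d_L is 1-Lipschitz. The energy identity bounds the H^1 norm
   of u by the L^2 norms of u and of f = exp(phi) M exp(-phi) u. Testing with the solution w of
   M w = cnj u (M is symmetric for the bilinear pairing) gives
   |u| <= C (|f| + gamma |u|), and the last term is absorbed for small gamma. *)

theory Submission
  imports Defs
begin

section \<open>Discrete Schroedinger operators on a finite set with a shift \<open>s\<close> and its
  inverse \<open>p\<close>\<close>

locale cyclic_schroedinger =
  fixes X :: "'a set" and s p :: "'a \<Rightarrow> 'a" and h :: real
    and V :: "'a \<Rightarrow> real" and lam :: complex and K :: real
  assumes finite_X: "finite X"
    and s_in: "x \<in> X \<Longrightarrow> s x \<in> X"
    and p_in: "x \<in> X \<Longrightarrow> p x \<in> X"
    and p_s: "x \<in> X \<Longrightarrow> p (s x) = x"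
    and s_p: "x \<in> X \<Longrightarrow> s (p x) = x"
    and h_pos: "h > 0"
    and V_bound: "x \<in> X \<Longrightarrow> \<bar>V x\<bar> \<le> K"
begin

text \<open>The mesh factor of the discrete L^2 norm is dropped, because it cancels in every
  operator norm.\<close>

definition nrm :: "('a \<Rightarrow> complex) \<Rightarrow> real" where
  "nrm u = L2_set (\<lambda>x. cmod (u x)) X"

definition D :: "('a \<Rightarrow> complex) \<Rightarrow> 'a \<Rightarrow> complex" where
  "D u x = (u (s x) - u x) / of_real h"

text \<open>This is lambda - H, with \<open>D\<close> composed with the backward difference written
  out as a three-point stencil.\<close>

definition M :: "('a \<Rightarrow> complex) \<Rightarrow> 'a \<Rightarrow> complex" where
  "M u x = lam * u x + (u (s x) + u (p x) - 2 * u x) / (of_real h)\<^sup>2 - of_real (V x) * u x"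

text \<open>A lower bound for this operator is an upper bound for the conjugated resolvent, which is
  its inverse.\<close>

definition Mconj :: "('a \<Rightarrow> real) \<Rightarrow> ('a \<Rightarrow> complex) \<Rightarrow> 'a \<Rightarrow> complex" where
  "Mconj \<phi> u x = of_real (exp (\<phi> x)) * M (\<lambda>z. of_real (exp (- \<phi> z)) * u z) x"

lemma nrm_nonneg [simp]: "nrm u \<ge> 0"
  by (simp add: nrm_def)

lemma nrm_cnj [simp]: "nrm (\<lambda>x. cnj (u x)) = nrm u"
  by (simp add: nrm_def)

lemma nrm_cong: "(\<And>x. x \<in> X \<Longrightarrow> u x = v x) \<Longrightarrow> nrm u = nrm v"
  unfolding nrm_def by (rule L2_set_cong) auto

lemma D_cnj: "D (\<lambda>x. cnj (u x)) = (\<lambda>x. cnj (D u x))"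
  by (simp add: D_def fun_eq_iff)

lemma sum_cnj_mult_self: "(\<Sum>x\<in>X. cnj (u x) * u x) = of_real ((nrm u)\<^sup>2)"
proof -
  have "(\<Sum>x\<in>X. cnj (u x) * u x) = (\<Sum>x\<in>X. of_real ((cmod (u x))\<^sup>2))"
    by (intro sum.cong refl) (simp only: complex_norm_square mult.commute)
  also have "\<dots> = of_real ((nrm u)\<^sup>2)"
    by (simp add: nrm_def L2_set_def sum_nonneg)
  finally show ?thesis .
qed

lemma weighted_Cauchy_Schwarz:
  assumes "c \<ge> 0" and "\<And>x. x \<in> X \<Longrightarrow> cmod (a x) \<le> c"
  shows "cmod (\<Sum>x\<in>X. a x * u x * v x) \<le> c * (nrm u * nrm v)"
proof -
  have "cmod (\<Sum>x\<in>X. a x * u x * v x) \<le> (\<Sum>x\<in>X. c * (\<bar>cmod (u x)\<bar> * \<bar>cmod (v x)\<bar>))"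
    by (rule sum_norm_le) (use assms in \<open>auto simp: norm_mult mult.assoc intro!: mult_right_mono\<close>)
  also have "\<dots> = c * (\<Sum>x\<in>X. \<bar>cmod (u x)\<bar> * \<bar>cmod (v x)\<bar>)"
    by (simp add: sum_distrib_left)
  also have "\<dots> \<le> c * (nrm u * nrm v)"
    unfolding nrm_def by (intro mult_left_mono L2_set_mult_ineq assms)
  finally show ?thesis .
qed

lemma Cauchy_Schwarz: "cmod (\<Sum>x\<in>X. u x * v x) \<le> nrm u * nrm v"
  using weighted_Cauchy_Schwarz[of 1 "\<lambda>_. 1" u v] by simp

lemma sum_shift: "(\<Sum>x\<in>X. f (s x)) = (\<Sum>x\<in>X. (f x :: complex))"
proof (rule sum.reindex_bij_betw)
  show "bij_betw s X X"
    by (rule bij_betwI[where g = p]) (auto simp: s_in p_in p_s s_p)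
qed

lemma sum_mult_p: "(\<Sum>x\<in>X. w x * u (p x)) = (\<Sum>x\<in>X. (w (s x) * u x :: complex))"
proof -
  have "(\<Sum>x\<in>X. w x * u (p x)) = (\<Sum>x\<in>X. w (s x) * u (p (s x)))"
    by (rule sum_shift[symmetric])
  also have "\<dots> = (\<Sum>x\<in>X. w (s x) * u x)"
    by (intro sum.cong) (auto simp: p_s)
  finally show ?thesis .
qed

text \<open>Summation by parts; no boundary terms occur because \<open>s\<close> permutes
  \<open>X\<close>.\<close>

lemma Green:
  "(\<Sum>x\<in>X. w x * M u x) =
     (\<Sum>x\<in>X. (lam - of_real (V x)) * w x * u x) - (\<Sum>x\<in>X. D w x * D u x)"
proof -
  let ?h = "(of_real h :: complex)\<^sup>2"
  have "(\<Sum>x\<in>X. w x * (u (s x) + u (p x) - 2 * u x)) =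
      (\<Sum>x\<in>X. w x * u (s x)) + (\<Sum>x\<in>X. w x * u (p x)) - (\<Sum>x\<in>X. w x * u x) - (\<Sum>x\<in>X. w x * u x)"
    by (simp flip: sum.distrib sum_subtractf add: algebra_simps)
  also have "\<dots> = (\<Sum>x\<in>X. w x * u (s x)) + (\<Sum>x\<in>X. w (s x) * u x)
      - (\<Sum>x\<in>X. w x * u x) - (\<Sum>x\<in>X. w (s x) * u (s x))"
    using sum_mult_p[of w u] sum_shift[of "\<lambda>x. w x * u x"] by simp
  also have "\<dots> = - (\<Sum>x\<in>X. (w (s x) - w x) * (u (s x) - u x))"
    by (simp flip: sum.distrib sum_subtractf sum_negf add: algebra_simps)
  finally have *: "(\<Sum>x\<in>X. w x * (u (s x) + u (p x) - 2 * u x)) =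
      - (\<Sum>x\<in>X. (w (s x) - w x) * (u (s x) - u x))" .
  have "(\<Sum>x\<in>X. w x * M u x) = (\<Sum>x\<in>X. (lam - of_real (V x)) * w x * u x) +
      (\<Sum>x\<in>X. w x * (u (s x) + u (p x) - 2 * u x)) / ?h"
    unfolding M_def sum_divide_distrib sum.distrib[symmetric]
    by (intro sum.cong) (auto simp: algebra_simps)
  also have "\<dots> = (\<Sum>x\<in>X. (lam - of_real (V x)) * w x * u x) - (\<Sum>x\<in>X. D w x * D u x)"
    unfolding * by (simp add: D_def sum_divide_distrib power2_eq_square)
  finally show ?thesis .
qed

text \<open>The pairing has no complex conjugation, so symmetry survives for nonreal
  \<open>lam\<close> and the dual problem is again governed by \<open>M\<close>.\<close>

lemma M_symmetric: "(\<Sum>x\<in>X. w x * M u x) = (\<Sum>x\<in>X. u x * M w x)"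
  unfolding Green by (simp add: mult_ac)

section \<open>Perturbation of the form under conjugation by an exponential weight\<close>

text \<open>This equals exp(phi) times the forward difference quotient of exp(-phi).\<close>

definition slope :: "('a \<Rightarrow> real) \<Rightarrow> 'a \<Rightarrow> real" where
  "slope \<phi> x = (exp (\<phi> x - \<phi> (s x)) - 1) / h"

text \<open>With a and b for the two slopes, (1 + h a)(1 + h b) = exp t * exp(-t) = 1. The factor h
  gained here cancels the 1/h in front of the zero-order term.\<close>

lemma slope_add: "slope \<phi> x + slope (\<lambda>z. - \<phi> z) x = - h * slope \<phi> x * slope (\<lambda>z. - \<phi> z) x"
proof -
  define t where "t = \<phi> x - \<phi> (s x)"
  have e: "- \<phi> x - - \<phi> (s x) = - t" "\<phi> x - \<phi> (s x) = t"
    by (auto simp: t_def)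
  have "exp t * exp (- t) = 1"
    by (simp flip: exp_add)
  then show ?thesis
    using h_pos unfolding slope_def e by (simp add: field_simps)
qed

text \<open>Pairing with a test function \<open>w\<close> moves one difference onto \<open>w\<close>, so that only first
  differences of the weight enter. The zero-order coefficient, a second difference of the
  exponential weight, becomes a product of two slopes by \<open>slope_add\<close>.\<close>

lemma Mconj_minus_M:
  "(\<Sum>x\<in>X. w x * (Mconj \<phi> u x - M u x)) =
     (\<Sum>x\<in>X. of_real (slope \<phi> x) * D u x * w x)
   + (\<Sum>x\<in>X. of_real (slope (\<lambda>z. - \<phi> z) x) * u x * D w x)
   - (\<Sum>x\<in>X. of_real (slope \<phi> x * slope (\<lambda>z. - \<phi> z) x) * u x * w x)"
proof -
  let ?a = "\<lambda>x. of_real (slope \<phi> x) :: complex"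
  let ?b = "\<lambda>x. of_real (slope (\<lambda>z. - \<phi> z) x) :: complex"
  have h: "of_real h \<noteq> (0::complex)" using h_pos by simp
  \<comment> \<open>Conjugation leaves the diagonal terms alone; only the couplings to the two
    neighbours change.\<close>
  have diff: "Mconj \<phi> u x - M u x = (?a x * u (s x) + ?b (p x) * u (p x)) / of_real h"
    if "x \<in> X" for x
  proof -
    define A where "A = (of_real (exp (\<phi> x)) :: complex)"
    define A' where "A' = (of_real (exp (- \<phi> x)) :: complex)"
    define B where "B = (of_real (exp (- \<phi> (s x))) :: complex)"
    define C where "C = (of_real (exp (- \<phi> (p x))) :: complex)"
    have AA: "A * A' = 1" unfolding A_def A'_def
      by (simp flip: of_real_mult exp_add)
    have a: "?a x = (A * B - 1) / of_real h"
      unfolding slope_def A_def B_def by (simp add: exp_diff exp_minus divide_inverse)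
    have b: "?b (p x) = (A * C - 1) / of_real h"
      unfolding slope_def A_def C_def using s_p[OF that] by (simp add: exp_diff exp_minus divide_inverse mult.commute)
    have "Mconj \<phi> u x = (A * A') * (lam * u x) + (A * B * u (s x) + A * C * u (p x) - 2 * (A * A') * u x) / (of_real h)\<^sup>2
        - (A * A') * (of_real (V x) * u x)"
      unfolding Mconj_def M_def A_def[symmetric] A'_def[symmetric] B_def[symmetric] C_def[symmetric]
      by (simp add: algebra_simps add_divide_distrib diff_divide_distrib)
    then show ?thesis
      unfolding AA a b M_def using h by (simp add: field_simps power2_eq_square)
  qed
  have ab: "?a x + ?b x = - (of_real h * (?a x * ?b x))" for x
    using arg_cong[OF slope_add[of \<phi> x], of "of_real :: real \<Rightarrow> complex"] by (simp add: mult_ac)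
  have "(\<Sum>x\<in>X. w x * (Mconj \<phi> u x - M u x)) =
      ((\<Sum>x\<in>X. w x * (?a x * u (s x))) + (\<Sum>x\<in>X. w x * (?b (p x) * u (p x)))) / of_real h"
    unfolding sum_divide_distrib sum.distrib[symmetric]
    by (intro sum.cong) (auto simp: diff algebra_simps)
  also have "(\<Sum>x\<in>X. w x * (?b (p x) * u (p x))) = (\<Sum>x\<in>X. w (s x) * (?b x * u x))"
    by (rule sum_mult_p[of w "\<lambda>x. ?b x * u x"])
  also have "((\<Sum>x\<in>X. w x * (?a x * u (s x))) + (\<Sum>x\<in>X. w (s x) * (?b x * u x))) / of_real h =
      (\<Sum>x\<in>X. ?a x * D u x * w x + ?b x * u x * D w x - (?a x * ?b x) * u x * w x)"
    unfolding sum_divide_distrib sum.distrib[symmetric]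
  proof (intro sum.cong refl)
    fix x
    \<comment> \<open>Both shifted values are expanded around \<open>x\<close>; the leftover
      coefficient a + b is of order h by \<open>ab\<close>.\<close>
    have E: "w x * (?a x * u (s x)) + w (s x) * (?b x * u x) =
        ?a x * (u (s x) - u x) * w x + ?b x * u x * (w (s x) - w x) + (?a x + ?b x) * (u x * w x)"
      by (simp add: algebra_simps)
    show "(w x * (?a x * u (s x)) + w (s x) * (?b x * u x)) / of_real h =
        ?a x * D u x * w x + ?b x * u x * D w x - (?a x * ?b x) * u x * w x"
      unfolding E ab D_def using h by (simp add: field_simps)
  qed
  finally show ?thesis
    by (simp add: sum.distrib sum_subtractf)
qed

text \<open>Cauchy-Schwarz on each of the three sums; the product of two slopes is at most e^2,
  hence at most e.\<close>

lemma Mconj_minus_M_bound: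
  assumes e: "0 \<le> e" "e \<le> 1"
    and a: "\<And>x. x \<in> X \<Longrightarrow> \<bar>slope \<phi> x\<bar> \<le> e" and b: "\<And>x. x \<in> X \<Longrightarrow> \<bar>slope (\<lambda>z. - \<phi> z) x\<bar> \<le> e"
  shows "cmod (\<Sum>x\<in>X. w x * (Mconj \<phi> u x - M u x)) \<le>
           e * (nrm (D u) * nrm w + nrm u * nrm (D w) + nrm u * nrm w)"
proof -
  have ab: "\<bar>slope \<phi> x * slope (\<lambda>z. - \<phi> z) x\<bar> \<le> e" if "x \<in> X" for x
  proof -
    have "\<bar>slope \<phi> x * slope (\<lambda>z. - \<phi> z) x\<bar> \<le> e * 1"
      unfolding abs_mult using a[OF that] b[OF that] e by (intro mult_mono) auto
    then show ?thesis by simp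
  qed
  let ?S1 = "\<Sum>x\<in>X. of_real (slope \<phi> x) * D u x * w x"
  let ?S2 = "\<Sum>x\<in>X. of_real (slope (\<lambda>z. - \<phi> z) x) * u x * D w x"
  let ?S3 = "\<Sum>x\<in>X. of_real (slope \<phi> x * slope (\<lambda>z. - \<phi> z) x) * u x * w x"
  have "cmod ?S1 \<le> e * (nrm (D u) * nrm w)" "cmod ?S2 \<le> e * (nrm u * nrm (D w))"
    "cmod ?S3 \<le> e * (nrm u * nrm w)"
    by (intro weighted_Cauchy_Schwarz; use a b ab e(1) in \<open>simp only: norm_of_real\<close>)+
  moreover have "cmod (?S1 + ?S2 - ?S3) \<le> cmod ?S1 + cmod ?S2 + cmod ?S3"
    by (meson norm_triangle_ineq norm_triangle_ineq4 add_right_mono order_trans)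
  ultimately show ?thesis
    unfolding Mconj_minus_M by (simp add: algebra_simps)
qed

section \<open>Energy estimate and absorption argument\<close>

text \<open>Testing Green's formula with \<open>cnj u\<close> isolates the square of
  \<open>nrm (D u)\<close>. Since e is at most 1/2, the perturbation contributes
  \<open>nrm (D u)\<close> only linearly, with coefficient at most \<open>nrm u\<close>.\<close>

lemma energy_estimate:
  assumes e: "0 \<le> e" "e \<le> 1 / 2"
    and a: "\<And>x. x \<in> X \<Longrightarrow> \<bar>slope \<phi> x\<bar> \<le> e" and b: "\<And>x. x \<in> X \<Longrightarrow> \<bar>slope (\<lambda>z. - \<phi> z) x\<bar> \<le> e"
    and K: "K \<ge> 0"
  shows "nrm (D u) \<le> (cmod lam + K + 2) * (nrm u + nrm (Mconj \<phi> u))"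
proof -
  define U where "U = nrm u"
  define F where "F = nrm (Mconj \<phi> u)"
  define G where "G = nrm (D u)"
  define A where "A = cmod lam + K"
  have nn: "U \<ge> 0" "F \<ge> 0" "G \<ge> 0" "A \<ge> 0"
    using K by (auto simp: U_def F_def G_def A_def)
  let ?w = "\<lambda>x. cnj (u x)"
  let ?S1 = "\<Sum>x\<in>X. (lam - of_real (V x)) * ?w x * u x"
  let ?S2 = "\<Sum>x\<in>X. ?w x * Mconj \<phi> u x"
  let ?S3 = "\<Sum>x\<in>X. ?w x * (Mconj \<phi> u x - M u x)"
  have "(\<Sum>x\<in>X. ?w x * M u x) = ?S2 - ?S3"
    by (simp flip: sum_subtractf add: algebra_simps)
  moreover have "(\<Sum>x\<in>X. D ?w x * D u x) = of_real (G\<^sup>2)"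
    unfolding D_cnj G_def by (rule sum_cnj_mult_self)
  ultimately have eq: "of_real (G\<^sup>2) = ?S1 - ?S2 + ?S3"
    using Green[of ?w u] by (simp add: algebra_simps)
  have "G\<^sup>2 = cmod (of_real (G\<^sup>2))" unfolding norm_of_real by simp
  also have "\<dots> \<le> cmod ?S1 + cmod ?S2 + cmod ?S3"
    unfolding eq by (meson norm_triangle_ineq norm_triangle_ineq4 add_right_mono order_trans)
  finally have S: "G * G \<le> cmod ?S1 + cmod ?S2 + cmod ?S3"
    by (simp only: power2_eq_square)
  have S1: "cmod ?S1 \<le> A * (U * U)"
  proof -
    have "cmod (lam - of_real (V x)) \<le> A" if "x \<in> X" for x
      using norm_triangle_ineq4[of lam "of_real (V x)"] V_bound[OF that] by (simp add: A_def)
    then show ?thesis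
      using weighted_Cauchy_Schwarz[of A "\<lambda>x. lam - of_real (V x)" ?w u] nn by (simp add: U_def)
  qed
  have S2: "cmod ?S2 \<le> U * F"
    using Cauchy_Schwarz[of ?w "Mconj \<phi> u"] by (simp add: U_def F_def)
  have "cmod ?S3 \<le> e * (G * U + U * G + U * U)"
    using Mconj_minus_M_bound[OF e(1) _ a b, of ?w u] e
    unfolding D_cnj nrm_cnj U_def F_def G_def by simp
  also have "\<dots> \<le> 1 / 2 * (G * U + U * G + U * U)"
    using e nn by (intro mult_right_mono) auto
  finally have S3: "cmod ?S3 \<le> G * U + 1 / 2 * (U * U)"
    by (simp add: field_simps)
  have main: "G * G \<le> A * (U * U) + U * F + G * U + U * U"
    by (rule order_trans[OF S order_trans[OF add_mono[OF add_mono[OF S1 S2] S3]]]) simp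
  \<comment> \<open>If this failed, G - U would be at least (A + 1) * (U + F); multiplying by G
    contradicts \<open>main\<close>, because G also exceeds U + F unless U = F = 0.\<close>
  have "G \<le> (A + 2) * (U + F)"
  proof (rule ccontr)
    assume "\<not> ?thesis"
    then have less: "(A + 2) * (U + F) < G" by simp
    have "(A + 1) * (U + F) \<le> G - U"
      using less nn by (simp add: algebra_simps)
    moreover have "0 < G" using less nn by (smt (verit) mult_nonneg_nonneg)
    ultimately have "G * ((A + 1) * (U + F)) \<le> G * (G - U)"
      by (intro mult_left_mono) auto
    moreover have "U + F < G \<or> U = 0 \<and> F = 0"
      using less nn by (smt (verit) mult_less_cancel_right1 mult_nonneg_nonneg mult_right_mono)
    ultimately have *: "(A + 1) * (U + F) * G \<le> A * (U * U) + U * F + U * U"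
      using main by (simp add: algebra_simps)
    show False
    proof (cases "U = 0 \<and> F = 0")
      case True
      then show False using main mult_pos_pos[OF \<open>0 < G\<close> \<open>0 < G\<close>] by simp
    next
      case False
      then have pos: "U + F > 0" and "U + F < G"
        using nn \<open>U + F < G \<or> U = 0 \<and> F = 0\<close> by auto
      then have "(A + 1) * (U + F) * (U + F) < (A + 1) * (U + F) * G"
        using nn by (intro mult_strict_left_mono mult_pos_pos) auto
      moreover have "A * (U * U) + U * F + U * U \<le> (A + 1) * (U + F) * (U + F)"
        using nn by (simp add: algebra_simps)
      ultimately show False using * by linarith
    qed
  qed
  then show ?thesis
    by (simp add: U_def F_def G_def A_def)
qed

text \<open>Duality: with M w = cnj u, the square of \<open>nrm u\<close> is the pairing of
  \<open>w\<close> with \<open>M u\<close>. The resolvent bound controls \<open>w\<close>, the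
  energy estimate controls \<open>D w\<close> and \<open>D u\<close>, and \<open>small\<close> lets
  the perturbation be absorbed.\<close>

lemma conjugated_resolvent_bound:
  fixes KG :: real
  assumes e: "0 \<le> e" "e \<le> 1 / 2"
    and a: "\<And>x. x \<in> X \<Longrightarrow> \<bar>slope \<phi> x\<bar> \<le> e" and b: "\<And>x. x \<in> X \<Longrightarrow> \<bar>slope (\<lambda>z. - \<phi> z) x\<bar> \<le> e"
    and K: "K \<ge> 0" and KG: "KG \<ge> 0"
    and surj: "\<And>g. \<exists>w. \<forall>x\<in>X. M w x = g x"
    and bound: "\<And>w. nrm w \<le> KG * nrm (M w)"
    and k: "k = cmod lam + K + 2"
    and small: "e * (KG * k + k * (KG + 1) + KG) \<le> 1 / 2"
  shows "nrm u \<le> 2 * (KG + KG * k) * nrm (Mconj \<phi> u)"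
proof -
  define U where "U = nrm u"
  define F where "F = nrm (Mconj \<phi> u)"
  define G where "G = nrm (D u)"
  have kpos: "k \<ge> 0" using K k by simp
  have nn: "U \<ge> 0" "F \<ge> 0" "G \<ge> 0"
    by (auto simp: U_def F_def G_def)
  have G: "G \<le> k * (U + F)"
    using energy_estimate[OF e a b K] by (simp add: U_def F_def G_def k)
  obtain w where w: "\<And>x. x \<in> X \<Longrightarrow> M w x = cnj (u x)"
    using surj[of "\<lambda>x. cnj (u x)"] by auto
  have Mw: "nrm (M w) = U"
    using nrm_cong[of "M w" "\<lambda>x. cnj (u x)"] w by (simp add: U_def)
  have W: "nrm w \<le> KG * U"
    using bound[of w] Mw by simp
  have DW: "nrm (D w) \<le> k * (KG + 1) * U"
  proof -
    \<comment> \<open>For zero weight the slopes vanish, so the energy estimate applies to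
      \<open>w\<close> with e = 0.\<close>
    have "Mconj (\<lambda>_. 0) w = M w" by (simp add: Mconj_def fun_eq_iff)
    then have "nrm (D w) \<le> k * (nrm w + U)"
      using energy_estimate[of 0 "\<lambda>_. 0" w] K Mw by (simp add: slope_def k)
    also have "\<dots> \<le> k * (KG * U + U)"
      using W kpos by (intro mult_left_mono) auto
    finally show ?thesis by (simp add: algebra_simps)
  qed
  let ?S1 = "\<Sum>x\<in>X. w x * Mconj \<phi> u x" and ?S2 = "\<Sum>x\<in>X. w x * (Mconj \<phi> u x - M u x)"
  have "of_real (U\<^sup>2) = (\<Sum>x\<in>X. u x * M w x)"
    unfolding U_def sum_cnj_mult_self[symmetric] by (intro sum.cong) (auto simp: w)
  also have "\<dots> = (\<Sum>x\<in>X. w x * M u x)"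
    by (rule M_symmetric)
  also have "\<dots> = ?S1 - ?S2"
    by (simp flip: sum_subtractf add: algebra_simps)
  finally have eq: "of_real (U\<^sup>2) = ?S1 - ?S2" .
  have "U\<^sup>2 = cmod (of_real (U\<^sup>2))" unfolding norm_of_real by simp
  also have "\<dots> \<le> cmod ?S1 + cmod ?S2"
    unfolding eq by (rule norm_triangle_ineq4)
  finally have "U\<^sup>2 \<le> cmod ?S1 + cmod ?S2" .
  moreover have "cmod ?S1 \<le> nrm w * F"
    unfolding F_def by (rule Cauchy_Schwarz)
  moreover have "nrm w * F \<le> KG * U * F"
    using W nn by (intro mult_right_mono) auto
  moreover have "cmod ?S2 \<le> e * (G * nrm w + U * nrm (D w) + U * nrm w)"
    using Mconj_minus_M_bound[OF e(1) _ a b, of w u] e unfolding U_def G_def by simp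
  moreover have "e * (G * nrm w + U * nrm (D w) + U * nrm w)
      \<le> e * (k * (U + F) * (KG * U) + U * (k * (KG + 1) * U) + U * (KG * U))"
    using e nn W DW G KG kpos by (intro mult_left_mono add_mono mult_mono) auto
  ultimately have "U\<^sup>2 \<le> KG * U * F + e * (k * (U + F) * (KG * U) + U * (k * (KG + 1) * U) + U * (KG * U))"
    by linarith
  \<comment> \<open>After one factor U is extracted, the coefficient of the remaining U is exactly
    the quantity in \<open>small\<close>.\<close>
  then have "U * U \<le> U * (KG * F + e * (KG * k) * F + e * (KG * k + k * (KG + 1) + KG) * U)"
    by (simp add: algebra_simps power2_eq_square)
  then have U: "U \<le> KG * F + e * (KG * k) * F + e * (KG * k + k * (KG + 1) + KG) * U \<or> U = 0"
    using nn by (auto simp: mult_le_cancel_left)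
  have S: "e * (KG * k + k * (KG + 1) + KG) * U \<le> 1 / 2 * U"
    using small nn by (intro mult_right_mono) auto
  have "e * (KG * k * F) \<le> 1 * (KG * k * F)"
    using e KG kpos nn by (intro mult_right_mono mult_nonneg_nonneg) auto
  then have T: "e * (KG * k) * F \<le> KG * k * F"
    by (simp add: mult.assoc)
  have nonneg: "0 \<le> KG * F" "0 \<le> KG * k * F"
    using KG kpos nn by auto
  from U have "U \<le> 2 * (KG * F + KG * k * F)"
  proof
    assume "U \<le> KG * F + e * (KG * k) * F + e * (KG * k + k * (KG + 1) + KG) * U"
    moreover have "x \<le> 2 * (a + d)" if "x \<le> a + b + c" "c \<le> 1 / 2 * x" "b \<le> d" for x a b c d :: real
      using that by simp
    ultimately show ?thesis using S T by blast
  qed (use nonneg in simp)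
  then show ?thesis
    unfolding U_def F_def by (simp add: algebra_simps)
qed

end

section \<open>The periodic grid as an instance of the abstract setting\<close>

locale grid_schroedinger =
  fixes L :: real and N :: nat and V :: "real \<Rightarrow> real" and lam :: complex and K :: real
  assumes L_pos: "L > 0" and N_pos: "N > 0"
    and V_bound_grid: "x \<in> grid L N \<Longrightarrow> \<bar>V x\<bar> \<le> K"
begin

lemma mesh_pos: "mesh L N > 0"
  using L_pos N_pos by (simp add: mesh_def)

lemma grid_bounds: "x \<in> grid L N \<Longrightarrow> 0 \<le> x \<and> x < L"
  using L_pos N_pos by (auto simp: grid_def mesh_def field_simps)

lemma zero_in_grid: "0 \<in> grid L N"
  using N_pos by (force simp: grid_def)

lemma rmod_in_grid:
  assumes "x \<in> grid L N"
  shows "(x + of_int j * mesh L N) rmod L \<in> grid L N"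
proof -
  obtain i where x: "x = real i * mesh L N" using assms by (auto simp: grid_def)
  \<comment> \<open>Reduction modulo L is the periodic extension of the identity, so the lattice
    formula turns it into reduction of the index modulo N.\<close>
  have "(x + of_int j * mesh L N) rmod L = periodic_ext L id (real_of_int (int i + j) * mesh L N)"
    by (simp add: periodic_ext_def x algebra_simps)
  also have "\<dots> = real_of_int ((int i + j) mod int N) * mesh L N"
    using periodic_ext_lattice[OF L_pos N_pos, of id "int i + j"] by simp
  also have "\<dots> = real (nat ((int i + j) mod int N)) * mesh L N"
    using N_pos by simp
  also have "\<dots> \<in> grid L N"
    unfolding grid_def using N_pos by (intro imageI) (simp add: nat_less_iff)
  finally show ?thesis .
qed

text \<open>Reduction changes x + t by a multiple of L only, and x is already the representative in
  [0, L). Taking t as plus and minus the mesh makes the two neighbour maps mutually inverse.\<close>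

lemma rmod_shift_back:
  assumes "x \<in> grid L N"
  shows "((x + t) rmod L - t) rmod L = x"
proof (rule rmod_unique)
  show "x \<in> {0..<\<bar>L\<bar>}"
    using grid_bounds[OF assms] by auto
  show "(x + t) rmod L - t = x + of_int (- \<lfloor>(x + t) / L\<rfloor>) * L"
    using L_pos by (simp add: rmod_def)
qed

sublocale cyclic_schroedinger "grid L N" "\<lambda>x. (x + mesh L N) rmod L" "\<lambda>x. (x - mesh L N) rmod L"
  "mesh L N" V lam K
proof
  show "finite (grid L N)" by (simp add: grid_def)
  fix x assume x: "x \<in> grid L N"
  show "(x + mesh L N) rmod L \<in> grid L N" "(x - mesh L N) rmod L \<in> grid L N"
    using rmod_in_grid[OF x, of 1] rmod_in_grid[OF x, of "-1"] by simp_all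
  show "((x + mesh L N) rmod L - mesh L N) rmod L = x" "((x - mesh L N) rmod L + mesh L N) rmod L = x"
    using rmod_shift_back[OF x, of "mesh L N"] rmod_shift_back[OF x, of "- mesh L N"] by simp_all
qed (use mesh_pos V_bound_grid in auto)

lemma L2_norm_eq: "L2_norm L N f = sqrt (mesh L N) * nrm f"
  by (simp add: L2_norm_def nrm_def L2_set_def real_sqrt_mult)

text \<open>The backward difference at the right neighbour looks back at \<open>x\<close> itself by
  \<open>p_s\<close>, which yields the three-point stencil across the periodic seam too.\<close>

lemma shifted_eq_M:
  assumes x: "x \<in> grid L N"
  shows "shifted lam L N V f x = M f x"
proof -
  have h: "of_real (mesh L N) \<noteq> (0::complex)" using mesh_pos by simp
  show ?thesis
    using x h s_in[OF x] p_s[OF x]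
    by (simp add: shifted_def hamiltonian_def Dplus_def Dminus_def mult_op_def periodic_ext_def M_def
        field_simps power2_eq_square)
qed

lemma M_cong:
  assumes "\<And>z. z \<in> grid L N \<Longrightarrow> u z = v z" and "x \<in> grid L N"
  shows "M u x = M v x"
  using assms s_in[of x] p_in[of x] by (simp add: M_def)

lemma shifted_in_grid_funs: "shifted lam L N V f \<in> grid_funs L N"
  by (auto simp: shifted_def grid_funs_def)

lemma shifted_eqI:
  assumes "f \<in> grid_funs L N" and "\<And>x. x \<in> grid L N \<Longrightarrow> M v x = f x"
  shows "shifted lam L N V v = f"
proof (rule PiE_ext)
  show "shifted lam L N V v \<in> grid L N \<rightarrow>\<^sub>E UNIV" "f \<in> grid L N \<rightarrow>\<^sub>E UNIV"
    using shifted_in_grid_funs assms(1) by (auto simp: grid_funs_def)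
qed (simp add: shifted_eq_M assms)

lemma op_norm_le:
  assumes "C \<ge> 0" and "\<And>f. f \<in> grid_funs L N \<Longrightarrow> nrm (A f) \<le> C * nrm f"
  shows "op_norm L N A \<le> C"
  unfolding op_norm_def
proof (rule cSUP_least)
  show "grid_funs L N \<noteq> {}"
    using shifted_in_grid_funs by blast
  fix f assume f: "f \<in> grid_funs L N"
  have "L2_norm L N (A f) / L2_norm L N f = nrm (A f) / nrm f"
    using mesh_pos by (simp add: L2_norm_eq)
  also have "\<dots> \<le> C"
    \<comment> \<open>If \<open>nrm f\<close> is 0, the quotient is 0 by convention and
      \<open>C \<ge> 0\<close> suffices.\<close>
    using assms(2)[OF f] \<open>C \<ge> 0\<close> nrm_nonneg[of f]
    by (cases "nrm f = 0") (auto simp: divide_le_eq less_le)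
  finally show "L2_norm L N (A f) / L2_norm L N f \<le> C" .
qed

text \<open>A real supremum dominates its set only if the set is bounded; B certifies this, and its
  size does not enter the conclusion.\<close>

lemma nrm_le_op_norm:
  assumes bnd: "\<And>f. f \<in> grid_funs L N \<Longrightarrow> nrm (A f) \<le> B * nrm f"
    and f: "f \<in> grid_funs L N"
  shows "nrm (A f) \<le> op_norm L N A * nrm f"
proof (cases "nrm f = 0")
  case True
  then show ?thesis using bnd[OF f] by simp
next
  case False
  have eq: "L2_norm L N (A g) / L2_norm L N g = nrm (A g) / nrm g" for g
    using mesh_pos by (simp add: L2_norm_eq)
  have "nrm (A g) / nrm g \<le> \<bar>B\<bar>" if "g \<in> grid_funs L N" for g
  proof (cases "nrm g = 0")
    case False
    then have "nrm g > 0" using nrm_nonneg[of g] by linarith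
    moreover have "B * nrm g \<le> \<bar>B\<bar> * nrm g"
      by (intro mult_right_mono) auto
    ultimately show ?thesis
      using order_trans[OF bnd[OF that]] by (simp only: pos_divide_le_eq)
  qed simp
  then have "nrm (A f) / nrm f \<le> op_norm L N A"
    unfolding op_norm_def eq by (intro cSUP_upper f bdd_aboveI2)
  moreover have "nrm f > 0" using False nrm_nonneg[of f] by linarith
  ultimately show ?thesis by (simp add: divide_le_eq)
qed

section \<open>The resolvent as inverse of lambda - H\<close>

context
  assumes inv: "invertible_op L N (shifted lam L N V)"
begin

abbreviation R :: grid_op where
  "R \<equiv> inverse_op L N (shifted lam L N V)"

lemma M_R:
  assumes "f \<in> grid_funs L N" "x \<in> grid L N"
  shows "M (R f) x = f x"
proof -
  have "shifted lam L N V (R f) = f"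
    using inv assms(1) unfolding invertible_op_def inverse_op_def
    by (metis bij_betw_def f_inv_into_f)
  then show ?thesis
    using shifted_eq_M[OF assms(2), of "R f"] by simp
qed

lemma R_eqI:
  assumes "f \<in> grid_funs L N" "v \<in> grid_funs L N" and "\<And>x. x \<in> grid L N \<Longrightarrow> M v x = f x"
  shows "R f = v"
  using shifted_eqI[OF assms(1,3)] inv assms(2) unfolding invertible_op_def inverse_op_def
  by (metis bij_betw_def inv_into_f_f)

text \<open>Finite dimension: \<open>R f\<close> is a superposition of the responses to point
  masses. The constant may depend on the grid, as it only makes the supremum in
  \<open>op_norm\<close> meaningful.\<close>

lemma R_bounded: "\<exists>B. \<forall>f\<in>grid_funs L N. nrm (R f) \<le> B * nrm f"
proof -
  define \<delta> :: "real \<Rightarrow> real \<Rightarrow> complex" where "\<delta> y = (\<lambda>x\<in>grid L N. if x = y then 1 else 0)" for y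
  define c where "c z = (\<Sum>y\<in>grid L N. cmod (R (\<delta> y) z))" for z
  have \<delta>: "\<delta> y \<in> grid_funs L N" for y
    by (simp add: \<delta>_def grid_funs_def)
  have "nrm (R f) \<le> L2_set c (grid L N) * nrm f" if f: "f \<in> grid_funs L N" for f
  proof -
    \<comment> \<open>\<open>R\<close> is given only as an inverse function, so its linearity is
      obtained indirectly: \<open>v\<close> solves the equation for \<open>f\<close> by linearity of
      \<open>M\<close>, and injectivity gives \<open>R f = v\<close>.\<close>
    define v where "v = (\<lambda>z\<in>grid L N. \<Sum>y\<in>grid L N. f y * R (\<delta> y) z)"
    have "M v x = f x" if x: "x \<in> grid L N" for x
    proof -
      have "M v x = M (\<lambda>z. \<Sum>y\<in>grid L N. f y * R (\<delta> y) z) x"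
        by (rule M_cong[OF _ x]) (simp add: v_def)
      also have "\<dots> = (\<Sum>y\<in>grid L N. f y * M (R (\<delta> y)) x)"
        unfolding M_def
        by (simp add: sum_distrib_left sum_divide_distrib algebra_simps add_divide_distrib
            diff_divide_distrib flip: sum.distrib sum_subtractf)
      also have "\<dots> = (\<Sum>y\<in>grid L N. if x = y then f y else 0)"
        unfolding M_R[OF \<delta> x] by (intro sum.cong) (use x in \<open>auto simp: \<delta>_def\<close>)
      also have "\<dots> = f x"
        using x finite_X by simp
      finally show ?thesis .
    qed
    then have "R f = v"
      by (intro R_eqI f) (auto simp: v_def grid_funs_def)
    moreover have "nrm v \<le> L2_set (\<lambda>z. nrm f * c z) (grid L N)"
      unfolding nrm_def[of v]
    proof (rule L2_set_mono)
      fix z assume z: "z \<in> grid L N"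
      have "cmod (v z) \<le> (\<Sum>y\<in>grid L N. cmod (f y) * cmod (R (\<delta> y) z))"
        unfolding v_def using z by (auto intro!: sum_norm_le simp: norm_mult)
      also have "\<dots> \<le> (\<Sum>y\<in>grid L N. nrm f * cmod (R (\<delta> y) z))"
        by (intro sum_mono mult_right_mono) (auto simp: nrm_def finite_X intro!: member_le_L2_set)
      finally show "cmod (v z) \<le> nrm f * c z"
        by (simp add: c_def sum_distrib_left)
    qed auto
    ultimately show ?thesis
      using L2_set_right_distrib[of "nrm f" c "grid L N"] by (simp add: mult.commute)
  qed
  then show ?thesis by blast
qed

lemma M_surj: "\<exists>w. \<forall>x\<in>grid L N. M w x = g x"
proof -
  have "restrict g (grid L N) \<in> grid_funs L N"
    by (simp add: grid_funs_def)
  from M_R[OF this] show ?thesis by auto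
qed

text \<open>On the grid, \<open>w\<close> is the resolvent applied to \<open>M w\<close>;
  restriction makes both functions extensional without changing their norms.\<close>

lemma nrm_le_nrm_M:
  assumes "op_norm L N R \<le> KG"
  shows "nrm w \<le> KG * nrm (M w)"
proof -
  let ?w = "restrict w (grid L N)"
  let ?g = "restrict (M w) (grid L N)"
  have g: "?g \<in> grid_funs L N" and w: "?w \<in> grid_funs L N"
    by (auto simp: grid_funs_def)
  obtain B where B: "\<And>f. f \<in> grid_funs L N \<Longrightarrow> nrm (R f) \<le> B * nrm f"
    using R_bounded by blast
  have "M ?w x = ?g x" if "x \<in> grid L N" for x
    using M_cong[of ?w w x] that by simp
  then have "R ?g = ?w"
    by (intro R_eqI g w)
  then have "nrm ?w \<le> op_norm L N R * nrm ?g"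
    using nrm_le_op_norm[OF B g] by simp
  also have "\<dots> \<le> KG * nrm ?g"
    using assms by (intro mult_right_mono) auto
  finally show ?thesis
    using nrm_cong[of ?w w] nrm_cong[of ?g "M w"] by simp
qed

text \<open>The inner exponentials cancel, then \<open>M\<close> cancels \<open>R\<close>, then the
  outer exponentials cancel.\<close>

lemma Mconj_R:
  assumes f: "f \<in> grid_funs L N" and x: "x \<in> grid L N"
  shows "Mconj \<phi> (mult_op L N (\<lambda>x. exp (\<phi> x)) (R (mult_op L N (\<lambda>x. exp (- \<phi> x)) f))) x = f x"
proof -
  let ?g = "mult_op L N (\<lambda>x. exp (- \<phi> x)) f"
  have g: "?g \<in> grid_funs L N"
    by (simp add: mult_op_def grid_funs_def)
  have e: "of_real (exp (- t)) * (of_real (exp t) * z) = z" "of_real (exp t) * (of_real (exp (- t)) * z) = z"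
    for t and z :: complex
    by (simp_all flip: of_real_mult exp_add mult.assoc)
  have "M (\<lambda>z. of_real (exp (- \<phi> z)) * mult_op L N (\<lambda>x. exp (\<phi> x)) (R ?g) z) x = M (R ?g) x"
    by (rule M_cong[OF _ x]) (simp add: mult_op_def e)
  also have "\<dots> = ?g x"
    by (rule M_R[OF g x])
  finally show ?thesis
    using x by (simp add: Mconj_def mult_op_def e)
qed

end

end

section \<open>Lipschitz bounds for the smoothed periodic distance\<close>

text \<open>Reverse triangle inequality for the complex numbers a + i and b + i.\<close>

lemma sqrt_square_plus_one_Lipschitz: "\<bar>sqrt (a\<^sup>2 + 1) - sqrt (b\<^sup>2 + 1)\<bar> \<le> \<bar>a - b\<bar>" for a b :: real
proof -
  have "\<bar>norm (Complex a 1) - norm (Complex b 1)\<bar> \<le> norm (Complex a 1 - Complex b 1)"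
    by (rule norm_triangle_ineq3)
  then show ?thesis by (simp add: cmod_def)
qed

text \<open>Reduction modulo L merely shifts the index k of the infimum by the floor of x /
  L.\<close>

lemma per_dist_rmod:
  assumes "L > 0"
  shows "per_dist L (x rmod L) y = per_dist L x y"
proof -
  have "range (\<lambda>k::int. \<bar>x rmod L - y - L * of_int k\<bar>) = (\<lambda>k. \<bar>x - y - L * of_int k\<bar>) ` range (\<lambda>k. k + \<lfloor>x / L\<rfloor>)"
    unfolding image_image using assms by (simp add: rmod_def algebra_simps)
  moreover have "range (\<lambda>k. k + \<lfloor>x / L\<rfloor>) = UNIV"
    by (rule surjI[of _ "\<lambda>k. k - \<lfloor>x / L\<rfloor>"]) simp
  ultimately show ?thesis
    by (simp add: per_dist_def)
qed

text \<open>The distance to each translate of y is 1-Lipschitz, and the infimum inherits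
  this.\<close>

lemma per_dist_Lipschitz: "per_dist L x y \<le> per_dist L x' y + \<bar>x - x'\<bar>"
proof -
  have "per_dist L x y - \<bar>x - x'\<bar> \<le> \<bar>x' - y - L * of_int k\<bar>" for k :: int
  proof -
    have "per_dist L x y \<le> \<bar>x - y - L * of_int k\<bar>"
      unfolding per_dist_def by (rule cINF_lower) (auto intro!: bdd_belowI2[where m = 0])
    then show ?thesis by linarith
  qed
  then have "per_dist L x y - \<bar>x - x'\<bar> \<le> per_dist L x' y"
    unfolding per_dist_def[of L x'] by (intro cINF_greatest) auto
  then show ?thesis by simp
qed

lemma smooth_dist_rmod: "L > 0 \<Longrightarrow> smooth_dist L (x rmod L) y = smooth_dist L x y"
  by (simp add: smooth_dist_def per_dist_rmod)

text \<open>The map from r to sqrt(r^2 + 1) is 1-Lipschitz and is applied twice, on top of the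
  1-Lipschitz periodic distance.\<close>

lemma smooth_dist_Lipschitz: "\<bar>smooth_dist L x y - smooth_dist L x' y\<bar> \<le> \<bar>x - x'\<bar>"
proof -
  define r r' where "r = per_dist L x y" and "r' = per_dist L x' y"
  have "\<bar>smooth_dist L x y - smooth_dist L x' y\<bar> \<le> \<bar>sqrt (r\<^sup>2 + 1) - sqrt (r'\<^sup>2 + 1)\<bar>"
    using sqrt_square_plus_one_Lipschitz[of "d_max L - sqrt (r\<^sup>2 + 1)" "d_max L - sqrt (r'\<^sup>2 + 1)"]
    unfolding smooth_dist_def r_def r'_def by linarith
  also have "\<dots> \<le> \<bar>r - r'\<bar>"
    by (rule sqrt_square_plus_one_Lipschitz)
  also have "\<dots> \<le> \<bar>x - x'\<bar>"
    using per_dist_Lipschitz[of L x y x'] per_dist_Lipschitz[of L x' y x]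
    by (simp add: r_def r'_def abs_minus_commute)
  finally show ?thesis .
qed

lemma abs_exp_minus_one_le:
  fixes t :: real
  assumes "\<bar>t\<bar> \<le> 1"
  shows "\<bar>exp t - 1\<bar> \<le> 2 * \<bar>t\<bar>"
proof (cases "t \<ge> 0")
  case True
  then have "exp t \<le> 1 + t + t\<^sup>2"
    using exp_bound assms by simp
  moreover have "t\<^sup>2 \<le> t * 1"
    unfolding power2_eq_square using True assms by (intro mult_left_mono) auto
  moreover have "exp t \<ge> 1" using True by simp
  ultimately show ?thesis using True by simp
next
  case False
  then show ?thesis
    using exp_ge_add_one_self[of t] exp_le_one_iff[of t] by linarith
qed

section \<open>Choice of constants and the uniform weighted resolvent bound\<close>

theorem theorem2p2:
  fixes lam :: complex and K_V K_G :: real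
  assumes "K_V > 0" and "K_G > 0"
  shows "\<exists>gamma0 > 0. \<exists>C > 0.
    \<forall>(L::real) (N::nat) (V::real \<Rightarrow> real).
      L \<ge> 1 \<longrightarrow> N \<ge> 1 \<longrightarrow> mesh L N \<le> 1 \<longrightarrow>
      Linf_norm L N (\<lambda>x. of_real (V x)) \<le> K_V \<longrightarrow>
      invertible_op L N (shifted lam L N V) \<longrightarrow>
      op_norm L N (inverse_op L N (shifted lam L N V)) \<le> K_G \<longrightarrow>
      (\<forall>\<gamma>::real. 0 \<le> \<gamma> \<and> \<gamma> \<le> gamma0 \<longrightarrow>
        (SUP y\<in>grid L N.
          op_norm L N
            (mult_op L N (\<lambda>x. exp (\<gamma> * smooth_dist L x y))
             \<circ> inverse_op L N (shifted lam L N V)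
             \<circ> mult_op L N (\<lambda>x. exp (- \<gamma> * smooth_dist L x y)))) \<le> C)"
proof -
  \<comment> \<open>\<open>k\<close> is the energy constant, \<open>Q\<close> the factor in the
    absorption condition and \<open>C\<close> the resulting bound. Slopes will be at most 2
    \<gamma>; the 1 + \<open>Q\<close> in \<open>g0\<close> makes both 2 \<gamma> and 2 \<gamma>
    \<open>Q\<close> at most 1/2.\<close>
  define k where "k = cmod lam + K_V + 2"
  define Q where "Q = K_G * k + k * (K_G + 1) + K_G"
  define C where "C = 2 * (K_G + K_G * k)"
  define g0 where "g0 = 1 / (4 * (1 + Q))"
  have k: "k > 0" using assms by (simp add: k_def add_nonneg_pos)
  have Q: "Q > 0" and C: "C > 0" using assms k by (auto simp: Q_def C_def intro!: add_pos_pos)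
  have g0: "g0 > 0" "g0 \<le> 1 / 4" "2 * g0 * Q \<le> 1 / 2"
    using Q by (simp_all add: g0_def field_simps)
  have "(SUP y\<in>grid L N.
          op_norm L N
            (mult_op L N (\<lambda>x. exp (\<gamma> * smooth_dist L x y))
             \<circ> inverse_op L N (shifted lam L N V)
             \<circ> mult_op L N (\<lambda>x. exp (- \<gamma> * smooth_dist L x y)))) \<le> C"
    if L: "L \<ge> 1" and N: "N \<ge> 1" and mesh: "mesh L N \<le> 1"
      and V: "Linf_norm L N (\<lambda>x. of_real (V x)) \<le> K_V"
      and inv: "invertible_op L N (shifted lam L N V)"
      and R: "op_norm L N (inverse_op L N (shifted lam L N V)) \<le> K_G"
      and \<gamma>: "0 \<le> \<gamma>" "\<gamma> \<le> g0"
    for L :: real and N :: nat and V :: "real \<Rightarrow> real" and \<gamma> :: real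
  proof -
    have Vb: "\<bar>V x\<bar> \<le> K_V" if "x \<in> grid L N" for x
    proof -
      have "cmod (of_real (V x)) \<le> Linf_norm L N (\<lambda>x. of_real (V x))"
        unfolding Linf_norm_def
        by (rule Max_ge) (use that in \<open>simp_all add: grid_def\<close>)
      then show ?thesis using V by simp
    qed
    interpret grid_schroedinger L N V lam K_V
      by standard (use L N Vb in auto)
    let ?e = "2 * \<gamma>"
    have e: "0 \<le> ?e" "?e \<le> 1 / 2" "?e * Q \<le> 1 / 2"
      using \<gamma> g0 mult_right_mono[of "2 * \<gamma>" "2 * g0" Q] Q by linarith+
    show ?thesis
    proof (rule cSUP_least)
      show "grid L N \<noteq> {}" using zero_in_grid by blast
      fix y
      define \<phi> where "\<phi> x = \<gamma> * smooth_dist L x y" for x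
      \<comment> \<open>Periodicity of the distance removes the wrap-around, so the seam of the grid
        obeys the same bound.\<close>
      have \<phi>: "\<bar>\<phi> x - \<phi> ((x + mesh L N) rmod L)\<bar> \<le> \<gamma> * mesh L N" for x
      proof -
        have "\<bar>\<phi> x - \<phi> ((x + mesh L N) rmod L)\<bar> = \<gamma> * \<bar>smooth_dist L x y - smooth_dist L (x + mesh L N) y\<bar>"
          using \<gamma> L by (simp add: \<phi>_def smooth_dist_rmod abs_mult flip: right_diff_distrib)
        also have "\<dots> \<le> \<gamma> * mesh L N"
          using smooth_dist_Lipschitz[of L x y "x + mesh L N"] \<gamma> mesh_pos by (intro mult_left_mono) auto
        finally show ?thesis .
      qed
      \<comment> \<open>Since \<gamma> and the mesh are at most 1, the exponent stays in [-1, 1];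
        dividing by the mesh then leaves a bound independent of N.\<close>
      have exp_bound: "\<bar>(exp t - 1) / mesh L N\<bar> \<le> ?e" if t: "\<bar>t\<bar> \<le> \<gamma> * mesh L N" for t
      proof -
        have "\<gamma> * mesh L N \<le> 1 * 1"
          using \<gamma> g0 mesh mesh_pos by (intro mult_mono) auto
        then have "\<bar>exp t - 1\<bar> \<le> 2 * (\<gamma> * mesh L N)"
          using abs_exp_minus_one_le[of t] t by linarith
        then show ?thesis using mesh_pos by (simp add: divide_le_eq)
      qed
      have a: "\<bar>slope \<phi> x\<bar> \<le> ?e" for x
        unfolding slope_def by (rule exp_bound[OF \<phi>])
      have b: "\<bar>slope (\<lambda>z. - \<phi> z) x\<bar> \<le> ?e" for x
        unfolding slope_def by (rule exp_bound) (use \<phi>[of x] in linarith)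
      let ?A = "mult_op L N (\<lambda>x. exp (\<phi> x)) \<circ> inverse_op L N (shifted lam L N V)
             \<circ> mult_op L N (\<lambda>x. exp (- \<phi> x))"
      have "op_norm L N ?A \<le> C"
      proof (rule op_norm_le)
        fix f assume f: "f \<in> grid_funs L N"
        \<comment> \<open>The absorption argument is applied to the conjugated resolvent of
          \<open>f\<close>, which \<open>Mconj\<close> maps back to \<open>f\<close> on the
          grid.\<close>
        have "nrm (?A f) \<le> C * nrm (Mconj \<phi> (?A f))"
          unfolding C_def
          by (rule conjugated_resolvent_bound[OF e(1,2) a b _ _ M_surj[OF inv] nrm_le_nrm_M[OF inv R] k_def])
            (use assms e(3) in \<open>auto simp: Q_def\<close>)
        also have "nrm (Mconj \<phi> (?A f)) = nrm f"
          by (rule nrm_cong) (use Mconj_R[OF inv f] in simp)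
        finally show "nrm (?A f) \<le> C * nrm f" .
      qed (use C in simp)
      then show "op_norm L N
            (mult_op L N (\<lambda>x. exp (\<gamma> * smooth_dist L x y))
             \<circ> inverse_op L N (shifted lam L N V)
             \<circ> mult_op L N (\<lambda>x. exp (- \<gamma> * smooth_dist L x y))) \<le> C"
        by (simp add: \<phi>_def)
    qed
  qed
  then show ?thesis
    using g0(1) C by blast
qed

end
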